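(* The following families of functions are strongly $2^{\mathfrak{c}}$-algebrable: (i) $\mathcal{PES}(\mathbb{C})$ (in the complex algebra $\mathbb{C}^{\mathbb{C}}$); (ii) $\mathcal{SES}(\mathbb{C})\setminus\mathcal{PES}(\mathbb{C})$ (in the complex algebra $\mathbb{C}^{\mathbb{C}}$); (iii) $\mathcal{EDD}(\mathbb{R})$ (in the real algebra $\mathbb{R}^{\mathbb{R}}$).
   Context: $\mathfrak{c}$ is the cardinality of the continuum. $\mathcal{PES}(\mathbb{C})$ is the set of perfectly everywhere surjective functions: functions $f:\mathbb{C}\to\mathbb{C}$ such that $f(P)=\mathbb{C}$ for every nonempty perfect set $P\subset\mathbb{C}$. $\mathcal{SES}(\mathbb{C})$ is the set of strongly everywhere surjective functions: functions $f:\mathbb{C}\to\mathbb{C}$ taking every value $z\in\mathbb{C}$ exactly $\mathfrak{c}$ many times on every nonempty open subset of $\mathbb{C}$. $\mathcal{EDD}(\mathbb{R})$ is the set of everywhere discontinuous Darboux functions: functions $f:\mathbb{R}\to\mathbb{R}$ that are continuous at no point and map connected sets onto connected sets. A subset $E$ of a commutative algebra $A$ is strongly $\lambda$-algebrable if $E\cup\{0\}$ contains a free algebra with $\lambda$ free generators; equivalently, there is $Y\subset E$ with $|Y|=\lambda$ such that for every $n\geq1$, every nonzero polynomial $P$ in $n$ variables (over the scalar field of $A$) without constant term and all distinct $y_1,\dots,y_n\in Y$ one has $P(y_1,\dots,y_n)\in E\setminus\{0\}$. Algebra operations on functions are pointwise. *)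

theory Defs
  imports
    "HOL-Analysis.Analysis"
    "HOL-Library.Poly_Mapping"
    "HOL-Library.Function_Algebras"
begin

section \<open>Classes of surjective and Darboux functions\<close>

text \<open>A closed set without isolated points. The empty set is perfect in this sense.\<close>

definition perfect_set :: "'a::topological_space set \<Rightarrow> bool" where
  "perfect_set P \<longleftrightarrow> closed P \<and> (\<forall>x\<in>P. x islimpt P)"

definition PES :: "(complex \<Rightarrow> complex) set" where
  "PES = {f. \<forall>P. perfect_set P \<and> P \<noteq> {} \<longrightarrow> f ` P = UNIV}"

text \<open>The cardinality of the continuum is expressed by equipollence with the real line.\<close>

definition SES :: "(complex \<Rightarrow> complex) set" where
  "SES = {f. \<forall>U z. open U \<and> U \<noteq> {} \<longrightarrow> {x \<in> U. f x = z} \<approx> (UNIV :: real set)}"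

definition EDD :: "(real \<Rightarrow> real) set" where
  "EDD = {f. (\<forall>x. \<not> isCont f x) \<and> (\<forall>S. connected S \<longrightarrow> connected (f ` S))}"

section \<open>Strong algebrability\<close>

text \<open>
  A polynomial over \<open>'k\<close> maps finitely many monomials to nonzero coefficients, and a monomial maps
  finitely many variables, numbered from 0, to nonzero exponents. The monomial \<open>0\<close> is the
  constant one.
\<close>

type_synonym 'k mpoly = "(nat \<Rightarrow>\<^sub>0 nat) \<Rightarrow>\<^sub>0 'k"

definition in_vars :: "nat \<Rightarrow> 'k::zero mpoly \<Rightarrow> bool" where
  "in_vars n P \<longleftrightarrow> (\<forall>m\<in>Poly_Mapping.keys P. Poly_Mapping.keys m \<subseteq> {..<n})"

definition mpoly_eval ::
  "('k::field \<Rightarrow> 'a::comm_ring_1 \<Rightarrow> 'a) \<Rightarrow> 'k mpoly \<Rightarrow> (nat \<Rightarrow> 'a) \<Rightarrow> 'a" where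
  "mpoly_eval smul P y =
    (\<Sum>m\<in>Poly_Mapping.keys P.
      smul (Poly_Mapping.lookup P m)
        (\<Prod>i\<in>Poly_Mapping.keys m. y i ^ Poly_Mapping.lookup m i))"

text \<open>
  The commutative algebra is the ring \<open>'a\<close> with the scalar multiplication \<open>smul\<close>. The cardinal
  number of generators is given by any set \<open>L\<close> of that cardinality.
\<close>

definition strongly_algebrable ::
  "('k::field \<Rightarrow> 'a::comm_ring_1 \<Rightarrow> 'a) \<Rightarrow> 'a set \<Rightarrow> 'b set \<Rightarrow> bool" where
  "strongly_algebrable smul E L \<longleftrightarrow>
    (\<exists>Y. Y \<subseteq> E \<and> Y \<approx> L \<and>
      (\<forall>n\<ge>1. \<forall>P y.
        in_vars n P \<and> P \<noteq> 0 \<and> Poly_Mapping.lookup P 0 = 0 \<and>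
        inj_on y {..<n} \<and> y ` {..<n} \<subseteq> Y \<longrightarrow>
        mpoly_eval smul P y \<in> E - {0}))"

text \<open>
  Together with the pointwise ring operations on functions, this is the algebra of all functions
  from \<open>'x\<close> to \<open>'k\<close>.
\<close>

definition fun_scale :: "'k::field \<Rightarrow> ('x \<Rightarrow> 'k) \<Rightarrow> 'x \<Rightarrow> 'k" where
  "fun_scale c f = (\<lambda>x. c * f x)"

end

theory Submission
  imports Defs "HOL-Computational_Algebra.Fundamental_Theorem_Algebra"
begin

text \<open>
  A code is a finite rule that assigns a scalar to every set of reals by looking at finitely many
  membership bits. Any values at finitely many distinct sets are realised by some code, and there
  are only continuum many codes. A Bernstein-type transfinite selection gives a map \<open>h\<close> from points
  to codes that is onto on every nonempty perfect set. The generators, one for every set \<open>A\<close> of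
  reals, send a point \<open>x\<close> to the value of the code \<open>h x\<close> at \<open>A\<close>; a polynomial in distinct generators
  then takes all values of that polynomial on every nonempty perfect set. Over the complex numbers
  these are all scalars; over the reals they form a nondegenerate interval. Making \<open>h\<close> the zero
  code on the real axis destroys surjectivity on that perfect set without affecting the fibres over
  open sets.
\<close>

section \<open>Polynomial evaluation: nonvanishing and ranges\<close>

lemma mpoly_eval_fun_scale:
  fixes P :: "'k::field mpoly" and y :: "nat \<Rightarrow> 'x \<Rightarrow> 'k"
  shows "mpoly_eval fun_scale P y x = mpoly_eval (*) P (\<lambda>i. y i x)"
proof -
  have p: "(f ^ k) x = f x ^ k" for f :: "'x \<Rightarrow> 'k" and k
    by (induction k) auto
  have q: "(\<Prod>i\<in>I. f i) x = (\<Prod>i\<in>I. f i x)" for f :: "nat \<Rightarrow> 'x \<Rightarrow> 'k" and I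
    by (induction I rule: infinite_finite_induct) auto
  have s: "(\<Sum>m\<in>M. f m) x = (\<Sum>m\<in>M. f m x)" for f :: "(nat \<Rightarrow>\<^sub>0 nat) \<Rightarrow> 'x \<Rightarrow> 'k" and M
    by (induction M rule: infinite_finite_induct) auto
  show ?thesis
    by (simp add: mpoly_eval_def s fun_scale_def q p)
qed

text \<open>Substituting univariate polynomials for the variables restricts \<open>P\<close> to a
  curve. The facts about one variable used below (few roots, the fundamental theorem of algebra, the
  intermediate value theorem) reach \<open>P\<close> through this identity.\<close>

lemma poly_mpoly_eval:
  "poly (mpoly_eval smult P u) t = mpoly_eval (*) P (\<lambda>i. poly (u i) t)"
  by (simp add: mpoly_eval_def poly_sum poly_prod)

text \<open>Variables missing from a monomial have exponent 0 and contribute a factor 1, so all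
  monomials can share the index set \<open>{..<n}\<close>.\<close>

lemma mpoly_eval_in_vars:
  assumes "in_vars n P"
  shows "mpoly_eval smul P y =
    (\<Sum>m\<in>Poly_Mapping.keys P. smul (Poly_Mapping.lookup P m) (\<Prod>i<n. y i ^ Poly_Mapping.lookup m i))"
proof -
  have "(\<Prod>i\<in>Poly_Mapping.keys m. y i ^ Poly_Mapping.lookup m i) = (\<Prod>i<n. y i ^ Poly_Mapping.lookup m i)"
    if "m \<in> Poly_Mapping.keys P" for m
    using assms that
    by (intro prod.mono_neutral_left) (auto simp: in_vars_def in_keys_iff)
  then show ?thesis by (simp add: mpoly_eval_def)
qed

lemma mpoly_eval_cong:
  assumes "in_vars n P" and "\<And>i. i < n \<Longrightarrow> y i = z i"
  shows "mpoly_eval smul P y = mpoly_eval smul P z"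
  by (simp add: mpoly_eval_in_vars[OF assms(1)] assms(2))

lemma mpoly_eval_zero:
  assumes "Poly_Mapping.lookup P 0 = 0"
  shows "mpoly_eval (*) P (\<lambda>_. 0) = 0"
proof -
  have "Poly_Mapping.keys m \<noteq> {}" if "m \<in> Poly_Mapping.keys P" for m
    using assms that by (metis keys_eq_empty in_keys_iff)
  then have "(\<Prod>i\<in>Poly_Mapping.keys m. 0 ^ Poly_Mapping.lookup m i) = (0::'a)"
    if "m \<in> Poly_Mapping.keys P" for m
    using that by (intro prod_zero) (fastforce simp: in_keys_iff)+
  then show ?thesis unfolding mpoly_eval_def by (intro sum.neutral) simp
qed

text \<open>Uniqueness of base \<open>N\<close> expansions: reduction mod \<open>N\<close> isolates
  the lowest digit, and cancelling it and dividing by \<open>N\<close> leaves a shorter expansion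
  for the induction.\<close>

lemma base_digits_unique:
  fixes a b :: "nat \<Rightarrow> nat"
  assumes "(\<Sum>i<n. N ^ i * a i) = (\<Sum>i<n. N ^ i * b i)"
    and "\<And>i. i < n \<Longrightarrow> a i < N" and "\<And>i. i < n \<Longrightarrow> b i < N" and "i < n"
  shows "a i = b i"
  using assms
proof (induction n arbitrary: a b i)
  case (Suc n)
  have split: "(\<Sum>i<Suc n. N ^ i * c i) = c 0 + N * (\<Sum>i<n. N ^ i * c (Suc i))" for c :: "nat \<Rightarrow> nat"
    by (simp add: sum.lessThan_Suc_shift sum_distrib_left mult.assoc del: sum.lessThan_Suc)
  have eq: "a 0 + N * (\<Sum>i<n. N ^ i * a (Suc i)) = b 0 + N * (\<Sum>i<n. N ^ i * b (Suc i))"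
    using Suc.prems(1) unfolding split .
  have lt: "a 0 < N" "b 0 < N" using Suc.prems by auto
  have 0: "a 0 = b 0"
    using arg_cong[OF eq, of "\<lambda>k. k mod N"] lt by simp
  then have "(\<Sum>i<n. N ^ i * a (Suc i)) = (\<Sum>i<n. N ^ i * b (Suc i))"
    using eq lt by auto
  then have "a (Suc j) = b (Suc j)" if "j < n" for j
    using Suc.IH[of "\<lambda>i. a (Suc i)" "\<lambda>i. b (Suc i)" j] Suc.prems that by auto
  with 0 Suc.prems(4) show ?case by (cases i) auto
qed simp

text \<open>Kronecker substitution: sending the variable \<open>i\<close> to \<open>t ^ N ^ i\<close> with \<open>N\<close> larger than all
  exponents keeps the monomials distinct.\<close>

lemma ex_mpoly_eval_nonzero:
  fixes P :: "'k::field_char_0 mpoly"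
  assumes P: "in_vars n P" and "P \<noteq> 0"
  shows "\<exists>w. mpoly_eval (*) P w \<noteq> 0"
proof -
  let ?K = "Poly_Mapping.keys P"
  have "finite ((\<lambda>(m, i). Poly_Mapping.lookup m i) ` (?K \<times> {..<n}))" by simp
  then obtain N where "\<forall>k\<in>(\<lambda>(m, i). Poly_Mapping.lookup m i) ` (?K \<times> {..<n}). k < N"
    using finite_nat_set_iff_bounded by blast
  then have N: "Poly_Mapping.lookup m i < N" if "m \<in> ?K" "i < n" for m i
    using that by auto
  define e where "e m = (\<Sum>i<n. N ^ i * Poly_Mapping.lookup m i)" for m
  define u where "u i = monom (1::'k) (N ^ i)" for i
  define Q where "Q = mpoly_eval smult P u"
  have inj: "m = m'" if "m \<in> ?K" "m' \<in> ?K" "e m = e m'" for m m'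
  proof (rule poly_mapping_eqI)
    fix i
    show "Poly_Mapping.lookup m i = Poly_Mapping.lookup m' i"
    proof (cases "i < n")
      case True
      show ?thesis
        using base_digits_unique[OF that(3)[unfolded e_def] _ _ True] N that(1,2) by blast
    next
      case False
      then have "i \<notin> Poly_Mapping.keys m" "i \<notin> Poly_Mapping.keys m'"
        using P that by (auto simp: in_vars_def)
      then show ?thesis by (simp add: in_keys_iff)
    qed
  qed
  have "(\<Prod>i<k. monom (1::'k) (f i)) = monom 1 (\<Sum>i<k. f i)" for f and k :: nat
    by (induction k) (auto simp: mult_monom)
  then have "(\<Prod>i<n. u i ^ Poly_Mapping.lookup m i) = monom 1 (e m)" for m
    by (simp add: u_def monom_power e_def)
  then have Q: "Q = (\<Sum>m\<in>?K. monom (Poly_Mapping.lookup P m) (e m))"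
    unfolding Q_def mpoly_eval_in_vars[OF P] by (simp add: smult_monom)
  obtain m where m: "m \<in> ?K" using \<open>P \<noteq> 0\<close> by (metis ex_in_conv keys_eq_empty)
  \<comment> \<open>As \<open>e\<close> is injective on the monomials of \<open>P\<close>, no other
    term of \<open>Q\<close> has degree \<open>e m\<close>, so nothing can cancel.\<close>
  have "coeff Q (e m) = (\<Sum>m'\<in>?K. if m' = m then Poly_Mapping.lookup P m' else 0)"
    unfolding Q coeff_sum coeff_monom using inj[OF _ m] by (intro sum.cong if_cong) blast+
  also have "\<dots> = Poly_Mapping.lookup P m" using m by simp
  finally have "Q \<noteq> 0" using m by (auto simp: in_keys_iff)
  then obtain t where "poly Q t \<noteq> 0" using poly_all_0_iff_0 by blast
  then show ?thesis unfolding Q_def poly_mpoly_eval by blast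
qed

text \<open>Along the line from 0 to a point \<open>w\<close> with nonzero value, \<open>P\<close>
  becomes a univariate polynomial that vanishes at 0 but not at 1. It is nonconstant, hence onto by
  the fundamental theorem of algebra.\<close>

lemma surj_mpoly_eval_complex:
  fixes P :: "complex mpoly"
  assumes "in_vars n P" "P \<noteq> 0" "Poly_Mapping.lookup P 0 = 0"
  shows "surj (mpoly_eval (*) P)"
proof -
  obtain w where w: "mpoly_eval (*) P w \<noteq> 0" using ex_mpoly_eval_nonzero assms by blast
  define Q where "Q = mpoly_eval smult P (\<lambda>i. [:0, w i:])"
  have Q: "poly Q t = mpoly_eval (*) P (\<lambda>i. t * w i)" for t
    by (simp add: Q_def poly_mpoly_eval)
  have Q01: "poly Q 0 = 0" "poly Q 1 \<noteq> 0" using w mpoly_eval_zero[OF assms(3)] by (simp_all add: Q)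
  have "z \<in> range (mpoly_eval (*) P)" for z
  proof -
    have "poly (Q - [:z:]) 1 \<noteq> poly (Q - [:z:]) 0" using Q01 by simp
    then have "\<not> constant (poly (Q - [:z:]))" unfolding constant_def by blast
    then obtain t where "poly (Q - [:z:]) t = 0" using fundamental_theorem_of_algebra by blast
    then show ?thesis by (auto simp: Q intro: sym)
  qed
  then show ?thesis by blast
qed

text \<open>Along the segment from \<open>v\<close> to \<open>w\<close>, \<open>P\<close> is a
  continuous function of one real variable, so intermediate values are attained there.\<close>

lemma connected_range_mpoly_eval_real:
  fixes P :: "real mpoly"
  shows "connected (range (mpoly_eval (*) P))"
  unfolding connected_iff_interval
proof (intro ballI allI impI)
  fix a b c
  assume "a \<in> range (mpoly_eval (*) P)" "b \<in> range (mpoly_eval (*) P)" and c: "a \<le> c" "c \<le> b"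
  then obtain v w where vw: "a = mpoly_eval (*) P v" "b = mpoly_eval (*) P w" by blast
  define Q where "Q = mpoly_eval smult P (\<lambda>i. [:v i, w i - v i:])"
  have Q: "poly Q t = mpoly_eval (*) P (\<lambda>i. v i + t * (w i - v i))" for t
    by (simp add: Q_def poly_mpoly_eval)
  have "poly Q 0 = a" "poly Q 1 = b" by (simp_all add: Q vw)
  moreover have "continuous_on {0..1} (poly Q)"
    by (intro continuous_at_imp_continuous_on ballI poly_isCont)
  ultimately obtain t where "poly Q t = c"
    using IVT'[of "poly Q" 0 c 1] c by auto
  then show "c \<in> range (mpoly_eval (*) P)" using Q by blast
qed

section \<open>Codes and the reduction to a surjection onto codes\<close>

text \<open>A code \<open>(xs, g)\<close> evaluates a set of reals by testing the membership of the finitely many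
  points \<open>xs\<close>; this is the mechanism behind the classical independent families of sets.\<close>

type_synonym 'k code = "real list \<times> (bool list \<Rightarrow> 'k)"

definition code_eval :: "'k code \<Rightarrow> real set \<Rightarrow> 'k" where
  "code_eval c A = snd c (map (\<lambda>r. r \<in> A) (fst c))"

text \<open>Choose a point \<open>d i j\<close> in exactly one of \<open>A i\<close> and
  \<open>A j\<close> for each pair of distinct indices. Testing all these points gives different bit
  lists \<open>t i\<close> to different indices, so the second component of a code can read off
  \<open>i\<close> and return \<open>w i\<close>.\<close>

lemma ex_code_eval_eq:
  assumes "finite I" "inj_on A I"
  shows "\<exists>c. \<forall>i\<in>I. code_eval c (A i) = w i"
proof -
  have "\<exists>r. i \<in> I \<longrightarrow> j \<in> I \<longrightarrow> i \<noteq> j \<longrightarrow> (r \<in> A i) \<noteq> (r \<in> A j)" for i j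
    using assms(2) by (metis inj_onD set_eqI)
  then obtain d where d: "\<And>i j. i \<in> I \<Longrightarrow> j \<in> I \<Longrightarrow> i \<noteq> j \<Longrightarrow> (d i j \<in> A i) \<noteq> (d i j \<in> A j)"
    by metis
  obtain xs where xs: "set xs = (\<lambda>(i, j). d i j) ` (I \<times> I)"
    using assms(1) by (metis finite_SigmaI finite_imageI finite_list)
  define t where "t i = map (\<lambda>r. r \<in> A i) xs" for i
  have "i = j" if "i \<in> I" "j \<in> I" "t i = t j" for i j
  proof (rule ccontr)
    assume "i \<noteq> j"
    moreover have "d i j \<in> set xs" using that xs by auto
    ultimately show False using d that by (auto simp: t_def)
  qed
  then have "inj_on t I" by (auto intro: inj_onI)
  then have "code_eval (xs, w \<circ> inv_into I t) (A i) = w i" if "i \<in> I" for i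
    using that inv_into_f_f[of t I i] by (simp add: code_eval_def t_def)
  then show ?thesis by blast
qed

text \<open>Any argument vector \<open>w\<close> is realised on the distinct sets \<open>A i\<close>
  by some code, and \<open>h\<close> attains that code on \<open>S\<close>.\<close>

lemma image_mpoly_eval_code:
  assumes P: "in_vars n P" and A: "inj_on A {..<n}" and h: "h ` S = UNIV"
  shows "(\<lambda>x. mpoly_eval (*) P (\<lambda>i. code_eval (h x) (A i))) ` S = range (mpoly_eval (*) P)"
proof (intro subset_antisym subsetI)
  fix v assume "v \<in> range (mpoly_eval (*) P)"
  then obtain w where w: "v = mpoly_eval (*) P w" by blast
  obtain c where c: "\<forall>i\<in>{..<n}. code_eval c (A i) = w i"
    using ex_code_eval_eq[OF _ A] by blast
  obtain x where "x \<in> S" "h x = c" using h by (metis UNIV_I image_iff)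
  moreover have "mpoly_eval (*) P (\<lambda>i. code_eval c (A i)) = v"
    unfolding w using c by (intro mpoly_eval_cong[OF P]) auto
  ultimately show "v \<in> (\<lambda>x. mpoly_eval (*) P (\<lambda>i. code_eval (h x) (A i))) ` S" by blast
qed auto

text \<open>Surjectivity of \<open>h\<close> makes the generators pairwise distinct and the
  polynomials in them nonzero. For each family only the membership in \<open>E\<close> is then left
  to check.\<close>

lemma strongly_algebrable_code:
  fixes E :: "('x \<Rightarrow> 'k::field_char_0) set" and h :: "'x \<Rightarrow> 'k code"
  assumes "surj h"
    and E: "\<And>n P A. in_vars n P \<Longrightarrow> P \<noteq> 0 \<Longrightarrow> Poly_Mapping.lookup P 0 = 0 \<Longrightarrow> inj_on A {..<n} \<Longrightarrow>
      (\<lambda>x. mpoly_eval (*) P (\<lambda>i. code_eval (h x) (A i))) \<in> E"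
  shows "strongly_algebrable fun_scale E (UNIV :: real set set)"
proof -
  define f where "f A x = code_eval (h x) A" for A x
  have "inj f"
  proof (rule injI, rule ccontr)
    fix A B assume "f A = f B" "A \<noteq> B"
    then have "inj_on (\<lambda>b. if b then A else B) UNIV" by (auto simp: inj_on_def)
    from ex_code_eval_eq[OF _ this, of "\<lambda>b. if b then 1 else 0 :: 'k"]
    obtain c :: "'k code" where "code_eval c A = 1" "code_eval c B = 0"
      by (metis (full_types) UNIV_I finite_code)
    moreover obtain x where "h x = c" using \<open>surj h\<close> by (metis surjD)
    ultimately show False using fun_cong[OF \<open>f A = f B\<close>, of x] by (simp add: f_def)
  qed
  have "f A \<in> E" for A
  proof -
    \<comment> \<open>This is the polynomial consisting of the single variable 0; its value at
      \<open>f A\<close> is \<open>f A\<close> itself, so the generators lie in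
      \<open>E\<close>.\<close>
    define P :: "'k mpoly" where "P = Poly_Mapping.single (Poly_Mapping.single 0 1) 1"
    have s: "Poly_Mapping.single (0::nat) (1::nat) \<noteq> 0" by (metis lookup_single_eq lookup_zero one_neq_zero)
    have "in_vars 1 P" "Poly_Mapping.lookup P 0 = 0"
      using s by (auto simp: P_def in_vars_def lookup_single when_def)
    moreover have "P \<noteq> 0"
      unfolding P_def by (metis lookup_single_eq lookup_zero one_neq_zero)
    ultimately show ?thesis
      using E[of 1 P "\<lambda>_. A"] by (simp add: mpoly_eval_def P_def f_def[abs_def] inj_on_def)
  qed
  moreover have "range f \<approx> (UNIV :: real set set)"
    using \<open>inj f\<close> by (simp add: inj_on_image_eqpoll_self)
  moreover have "mpoly_eval fun_scale P y \<in> E - {0}"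
    if P: "in_vars n P" "P \<noteq> 0" "Poly_Mapping.lookup P 0 = 0"
      and y: "inj_on y {..<n}" "y ` {..<n} \<subseteq> range f" for n P y
  proof -
    \<comment> \<open>The choice of \<open>A i\<close> is meaningful only for \<open>i < n\<close>;
      \<open>P\<close> does not see the other indices.\<close>
    define A where "A i = inv f (y i)" for i
    have yA: "y i = f (A i)" if "i < n" for i
      using y(2) that by (auto simp: A_def f_inv_into_f image_subset_iff)
    then have A: "inj_on A {..<n}"
      using y(1) by (metis inj_on_def lessThan_iff)
    define F where "F x = mpoly_eval (*) P (\<lambda>i. code_eval (h x) (A i))" for x
    have eq: "mpoly_eval fun_scale P y = F"
    proof
      fix x
      show "mpoly_eval fun_scale P y x = F x"
        unfolding mpoly_eval_fun_scale F_def
        by (rule mpoly_eval_cong[OF P(1)]) (simp add: yA f_def)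
    qed
    have "range F = range (mpoly_eval (*) P)"
      unfolding F_def using image_mpoly_eval_code[OF P(1) A \<open>surj h\<close>] .
    moreover obtain w where "mpoly_eval (*) P w \<noteq> 0"
      using ex_mpoly_eval_nonzero[OF P(1,2)] by blast
    ultimately have "F \<noteq> 0" by (metis rangeE rangeI zero_fun_apply)
    moreover have "F \<in> E" unfolding F_def using E[OF P A] .
    ultimately show ?thesis by (simp add: eq)
  qed
  ultimately show ?thesis
    unfolding strongly_algebrable_def by (intro exI[of _ "range f"]) auto
qed

section \<open>Sets of at most continuum size\<close>

text \<open>With the values coded as sets of naturals, a function on a countable type becomes one
  set of naturals, namely its graph as a set of encoded pairs.\<close>

lemma fun_countable_lepoll_reals:
  assumes "(UNIV :: 'k set) \<lesssim> (UNIV :: real set)"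
  shows "(UNIV :: ('c::countable \<Rightarrow> 'k) set) \<lesssim> (UNIV :: real set)"
proof -
  have "(UNIV :: 'k set) \<lesssim> (UNIV :: nat set set)"
    using assms nat_sets_eqpoll_reals eqpoll_sym lepoll_trans2 by blast
  then obtain e :: "'k \<Rightarrow> nat set" where e: "inj e" by (auto simp: lepoll_def)
  define F :: "('c \<Rightarrow> 'k) \<Rightarrow> nat set"
    where "F g = {prod_encode (to_nat i, j) | i j. j \<in> e (g i)}" for g
  have F: "prod_encode (to_nat i, j) \<in> F g \<longleftrightarrow> j \<in> e (g i)" for i j g
    by (auto simp: F_def)
  have "inj F"
  proof (rule injI)
    fix g g' assume "F g = F g'"
    then have "e (g i) = e (g' i)" for i using F by blast
    then show "g = g'" using e by (intro ext) (rule injD)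
  qed
  then have "(UNIV :: ('c \<Rightarrow> 'k) set) \<lesssim> (UNIV :: nat set set)" by (auto simp: lepoll_def)
  then show ?thesis using nat_sets_eqpoll_reals lepoll_trans2 by blast
qed

lemma prod_lepoll_reals:
  assumes "A \<lesssim> (UNIV :: real set)" "B \<lesssim> (UNIV :: real set)"
  shows "A \<times> B \<lesssim> (UNIV :: real set)"
proof -
  have "A \<times> B \<lesssim> (UNIV :: real set) \<times> (UNIV :: real set)" using assms times_lepoll_mono by blast
  also have "\<dots> \<lesssim> (UNIV :: (bool \<Rightarrow> real) set)"
    unfolding lepoll_def
    by (rule exI[of _ "\<lambda>(x, y) b. if b then x else y"]) (auto simp: inj_on_def fun_eq_iff split: if_splits)
  also have "\<dots> \<lesssim> (UNIV :: real set)" by (rule fun_countable_lepoll_reals) simp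
  finally show ?thesis .
qed

lemma list_lepoll_reals: "(UNIV :: real list set) \<lesssim> (UNIV :: real set)"
proof -
  \<comment> \<open>\<open>None\<close> records the length. Beyond the length \<open>xs ! i\<close>
    is an unspecified value, which is harmless because equal lengths and equal entries already
    determine the list.\<close>
  define F :: "real list \<Rightarrow> nat option \<Rightarrow> real"
    where "F xs k = (case k of None \<Rightarrow> real (length xs) | Some i \<Rightarrow> xs ! i)" for xs k
  have "inj F"
  proof (rule injI)
    fix xs ys assume eq: "F xs = F ys"
    have "length xs = length ys" using fun_cong[OF eq, of None] by (simp add: F_def)
    moreover have "xs ! i = ys ! i" for i using fun_cong[OF eq, of "Some i"] by (simp add: F_def)
    ultimately show "xs = ys" by (simp add: nth_equalityI)
  qed
  then have "(UNIV :: real list set) \<lesssim> (UNIV :: (nat option \<Rightarrow> real) set)" by (auto simp: lepoll_def)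
  also have "\<dots> \<lesssim> (UNIV :: real set)" by (rule fun_countable_lepoll_reals) simp
  finally show ?thesis .
qed

lemma complex_lepoll_reals: "(A :: complex set) \<lesssim> (UNIV :: real set)"
proof -
  have "inj_on (\<lambda>z. (Re z, Im z)) A" by (auto simp: inj_on_def complex_eq_iff)
  then have "A \<lesssim> (UNIV :: real set) \<times> (UNIV :: real set)"
    by (auto simp: lepoll_def)
  then show ?thesis using prod_lepoll_reals lepoll_trans by blast
qed

lemma ex_surj_real_code:
  assumes "(UNIV :: 'k set) \<lesssim> (UNIV :: real set)"
  shows "\<exists>\<phi> :: real \<Rightarrow> 'k code. surj \<phi>"
proof -
  have "(UNIV :: 'k code set) \<lesssim> (UNIV :: real set)"
    using prod_lepoll_reals[OF list_lepoll_reals fun_countable_lepoll_reals[OF assms]] by simp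
  then show ?thesis by (auto simp: lepoll_iff)
qed

text \<open>A closed set is determined by the members of a countable basis that miss it, hence by a
  set of naturals.\<close>

lemma closed_sets_lepoll_reals:
  "{C :: 'a::second_countable_topology set. closed C} \<lesssim> (UNIV :: real set)"
proof -
  obtain B :: "'a set set" where B: "countable B" "topological_basis B"
    using ex_countable_basis by blast
  define F where "F C = to_nat_on B ` {U \<in> B. U \<subseteq> - C}" for C
  have "inj_on F {C. closed C}"
  proof (rule inj_onI)
    fix C D assume CD: "C \<in> {C. closed C}" "D \<in> {C. closed C}" "F C = F D"
    have "{U \<in> B. U \<subseteq> - C} = {U \<in> B. U \<subseteq> - D}"
      using CD(3) inj_on_image_eq_iff[OF inj_on_to_nat_on[OF B(1)]] unfolding F_def
      by (metis (no_types, lifting) mem_Collect_eq subsetI)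
    moreover have "- C = \<Union>{U \<in> B. U \<subseteq> - C}" if "closed C" for C
      using that B(2) topological_basisE[of B "- C"] by (blast intro: open_Compl)
    ultimately show "C = D" using CD(1,2) by (metis (no_types, lifting) double_complement mem_Collect_eq)
  qed
  then have "{C :: 'a set. closed C} \<lesssim> (UNIV :: nat set set)" by (auto simp: lepoll_def)
  then show ?thesis using nat_sets_eqpoll_reals lepoll_trans2 by blast
qed

section \<open>Transfinite selection and Bernstein-type functions\<close>

text \<open>Recursion along a well-order of \<open>T\<close> of minimal type: the predecessors of
  \<open>t\<close> are fewer than \<open>T\<close>, so the values already chosen cannot exhaust
  \<open>P t\<close>, and a fresh one remains.\<close>

lemma ex_inj_selection:
  fixes T :: "'i set" and P :: "'i \<Rightarrow> 'a set"
  assumes P: "\<And>t. t \<in> T \<Longrightarrow> T \<lesssim> P t"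
  shows "\<exists>x. inj_on x T \<and> (\<forall>t\<in>T. x t \<in> P t)"
proof -
  define r where "r = card_of T"
  have co: "Card_order r" and fr: "Field r = T" unfolding r_def by (rule card_of_Card_order, rule Field_card_of)
  then have wo: "Well_order r" by (simp add: card_order_on_def)
  have "wf {(s, t). s \<in> underS r t}"
  proof -
    have "{(s, t). s \<in> underS r t} = r - Id" by (auto simp: underS_def)
    then show ?thesis using wo by (simp add: well_order_on_def)
  qed
  then have "\<exists>x. \<forall>t. t \<in> T \<longrightarrow> x t \<in> P t \<and> x t \<notin> x ` underS r t"
  proof (rule dependent_wf_choice)
    fix f g :: "'i \<Rightarrow> 'a" and t v
    assume "\<And>z. (z, t) \<in> {(s, t). s \<in> underS r t} \<Longrightarrow> f z = g z"
    then have "f ` underS r t = g ` underS r t" by (intro image_cong) auto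
    then show "(t \<in> T \<longrightarrow> v \<in> P t \<and> v \<notin> f ` underS r t) = (t \<in> T \<longrightarrow> v \<in> P t \<and> v \<notin> g ` underS r t)"
      by simp
  next
    fix t and f :: "'i \<Rightarrow> 'a"
    have "\<not> P t \<subseteq> f ` underS r t" if t: "t \<in> T"
    proof
      assume "P t \<subseteq> f ` underS r t"
      then have "T \<lesssim> underS r t"
        by (rule lepoll_trans[OF P[OF t] subset_image_lepoll])
      moreover have "(card_of (underS r t), card_of T) \<in> ordLess"
        using card_of_underS[OF co] t fr by (simp add: r_def)
      ultimately show False by (metis card_of_ordLeq lepoll_def not_ordLess_ordLeq)
    qed
    then show "\<exists>v. t \<in> T \<longrightarrow> v \<in> P t \<and> v \<notin> f ` underS r t" by blast
  qed
  then obtain x where x: "\<And>t. t \<in> T \<Longrightarrow> x t \<in> P t \<and> x t \<notin> x ` underS r t" by blast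
  have "inj_on x T"
  proof (rule inj_onI, rule ccontr)
    fix s t assume st: "s \<in> T" "t \<in> T" "x s = x t" "s \<noteq> t"
    have "(s, t) \<in> r \<or> (t, s) \<in> r"
      using wo st fr by (auto simp: order_on_defs total_on_def)
    then have "s \<in> underS r t \<or> t \<in> underS r s" using st by (auto simp: underS_def)
    then show False using x st by (metis imageI)
  qed
  then show ?thesis using x by blast
qed

text \<open>A perfect set in the present sense equals its derived set, and in a completely
  metrizable space such a nonempty set has at least continuum many points.\<close>

lemma perfect_set_lepoll:
  fixes P :: "'a::polish_space set"
  assumes "perfect_set P" "P \<noteq> {}"
  shows "(UNIV :: real set) \<lesssim> P"
proof (rule lepoll_perfect_set)
  show "completely_metrizable_space (euclidean :: 'a topology) \<or>
    locally_compact_space (euclidean :: 'a topology) \<and> Hausdorff_space (euclidean :: 'a topology)"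
    using completely_metrizable_space_euclidean by blast
  have "euclidean derived_set_of P = {x. x islimpt P}"
    unfolding derived_set_of_def islimpt_def by (simp add: open_openin[symmetric]) blast
  then show "euclidean derived_set_of P = P"
    using assms(1) unfolding perfect_set_def closed_limpt by blast
qed fact

text \<open>The requirements are the pairs \<open>(P, v)\<close>: some point of \<open>P\<close>
  must receive the value \<open>v\<close>. There are at most continuum many of them and each
  \<open>P\<close> has at least that many points, so distinct requirements can be given distinct
  points.\<close>

lemma ex_bernstein_function:
  "\<exists>h :: 'a::polish_space \<Rightarrow> real. \<forall>P. perfect_set P \<and> P \<noteq> {} \<longrightarrow> h ` P = UNIV"
proof -
  define T :: "('a set \<times> real) set" where "T = {P. perfect_set P \<and> P \<noteq> {}} \<times> UNIV"
  have "{P :: 'a set. perfect_set P \<and> P \<noteq> {}} \<lesssim> {P :: 'a set. closed P}"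
    by (rule subset_imp_lepoll) (auto simp: perfect_set_def)
  then have "T \<lesssim> (UNIV :: real set)"
    unfolding T_def using closed_sets_lepoll_reals lepoll_trans by (intro prod_lepoll_reals) auto
  then have "T \<lesssim> fst t" if "t \<in> T" for t
    using that perfect_set_lepoll lepoll_trans unfolding T_def by fastforce
  from ex_inj_selection[of T fst, OF this]
  obtain x where x: "inj_on x T" "\<And>t. t \<in> T \<Longrightarrow> x t \<in> fst t" by blast
  \<comment> \<open>Injectivity of \<open>x\<close> makes the value at a selected point unambiguous.
    At points outside the image of \<open>T\<close> the value is arbitrary.\<close>
  have "v \<in> (\<lambda>y. snd (inv_into T x y)) ` P" if "perfect_set P" "P \<noteq> {}" for P v
  proof -
    have "(P, v) \<in> T" using that by (simp add: T_def)
    then have "x (P, v) \<in> P" "snd (inv_into T x (x (P, v))) = v"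
      using x(2)[of "(P, v)"] inv_into_f_f[OF x(1)] by simp_all
    then show ?thesis by (intro image_eqI[where x = "x (P, v)"]) simp_all
  qed
  then show ?thesis by blast
qed

lemma ex_bernstein_code:
  assumes "(UNIV :: 'k set) \<lesssim> (UNIV :: real set)"
  shows "\<exists>h :: 'a::polish_space \<Rightarrow> 'k code. \<forall>P. perfect_set P \<and> P \<noteq> {} \<longrightarrow> h ` P = UNIV"
proof -
  obtain g :: "'a \<Rightarrow> real" where g: "\<forall>P. perfect_set P \<and> P \<noteq> {} \<longrightarrow> g ` P = UNIV"
    using ex_bernstein_function by blast
  obtain \<phi> :: "real \<Rightarrow> 'k code" where "surj \<phi>" using ex_surj_real_code[OF assms] by blast
  then have "(\<phi> \<circ> g) ` P = UNIV" if "perfect_set P" "P \<noteq> {}" for P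
    using g that by (metis image_comp)
  then show ?thesis by blast
qed

section \<open>Perfect connected sets and the three families\<close>

lemma perfect_set_connected:
  fixes S :: "'a::metric_space set"
  assumes "closed S" "connected S" "a \<in> S" "b \<in> S" "a \<noteq> b"
  shows "perfect_set S"
  using assms connected_imp_perfect[of S] unfolding perfect_set_def by (metis singletonD)

lemma perfect_set_closed_segment:
  fixes a b :: "'a::euclidean_space"
  assumes "a \<noteq> b"
  shows "perfect_set (closed_segment a b)"
  using assms by (intro perfect_set_connected[of _ a b]) auto

lemma strongly_algebrable_PES: "strongly_algebrable fun_scale PES (UNIV :: real set set)"
proof -
  obtain h :: "complex \<Rightarrow> complex code" where h: "\<And>P. perfect_set P \<Longrightarrow> P \<noteq> {} \<Longrightarrow> h ` P = UNIV"
    using ex_bernstein_code[OF complex_lepoll_reals] by blast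
  show ?thesis
  proof (rule strongly_algebrable_code)
    have "h ` closed_segment 0 1 = UNIV" by (intro h perfect_set_closed_segment) auto
    then show "surj h" by blast
  next
    fix n and P :: "complex mpoly" and A :: "nat \<Rightarrow> real set"
    assume P: "in_vars n P" "P \<noteq> 0" "Poly_Mapping.lookup P 0 = 0" and A: "inj_on A {..<n}"
    show "(\<lambda>x. mpoly_eval (*) P (\<lambda>i. code_eval (h x) (A i))) \<in> PES"
      unfolding PES_def using image_mpoly_eval_code[OF P(1) A h] surj_mpoly_eval_complex[OF P] by auto
  qed
qed

text \<open>A ball inside \<open>U\<close> contains continuum many disjoint vertical segments. Each
  is perfect, so \<open>S\<close> meets it, and the real part tells the chosen points apart.\<close>

lemma eqpoll_reals_of_segments:
  fixes S U :: "complex set"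
  assumes S: "\<And>Q. perfect_set Q \<Longrightarrow> Q \<noteq> {} \<Longrightarrow> Q \<subseteq> U \<Longrightarrow> S \<inter> Q \<noteq> {}" and U: "open U" "U \<noteq> {}"
  shows "S \<inter> U \<approx> (UNIV :: real set)"
proof (rule lepoll_antisym)
  show "S \<inter> U \<lesssim> (UNIV :: real set)"
    by (rule complex_lepoll_reals)
  obtain z e where ze: "e > 0" "cball z e \<subseteq> U" using U open_contains_cball by blast
  \<comment> \<open>Offset and height are both at most \<open>e / 2\<close>, so the endpoints are
    within \<open>e\<close> of \<open>z\<close> and convexity keeps the whole segment in
    \<open>cball z e\<close>.\<close>
  define Q where "Q t = closed_segment (Complex (Re z + t) (Im z)) (Complex (Re z + t) (Im z + e / 2))" for t
  have "\<exists>x. x \<in> S \<inter> U \<and> Re x = Re z + t" if t: "t \<in> {0..e / 2}" for t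
  proof -
    have "Complex (Re z + t) (Im z + s) \<in> cball z e" if "s \<in> {0..e / 2}" for s
    proof -
      have "cmod (Complex t s) \<le> \<bar>t\<bar> + \<bar>s\<bar>" using cmod_le[of "Complex t s"] by simp
      moreover have "z - Complex (Re z + t) (Im z + s) = - Complex t s" by (simp add: complex_eq_iff)
      ultimately show ?thesis using t that by (auto simp: dist_norm)
    qed
    from this[of 0] this[of "e / 2"] have "Q t \<subseteq> cball z e"
      unfolding Q_def using ze(1) by (intro closed_segment_subset) auto
    moreover have "perfect_set (Q t)" "Q t \<noteq> {}"
      unfolding Q_def using ze(1) by (auto intro: perfect_set_closed_segment)
    ultimately obtain x where "x \<in> S \<inter> U" "x \<in> Q t" using S[of "Q t"] ze(2) by blast
    moreover from this have "Re x = Re z + t"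
      by (auto simp: Q_def closed_segment_def) (simp add: algebra_simps)
    ultimately show ?thesis by blast
  qed
  then obtain x where x: "\<And>t. t \<in> {0..e / 2} \<Longrightarrow> x t \<in> S \<inter> U \<and> Re (x t) = Re z + t" by metis
  have "inj_on x {0..e / 2}" by (rule inj_onI) (metis add_left_imp_eq x)
  then have "{0..e / 2} \<lesssim> S \<inter> U" using x unfolding lepoll_def by blast
  moreover have "(UNIV :: real set) \<approx> {0..e / 2}"
    using ze(1) by (intro eqpoll_sym[OF closed_interval_eqpoll_reals[THEN iffD2]]) auto
  ultimately show "(UNIV :: real set) \<lesssim> S \<inter> U" using lepoll_trans1 by blast
qed

lemma strongly_algebrable_SES_minus_PES:
  "strongly_algebrable fun_scale (SES - PES) (UNIV :: real set set)"
proof -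
  obtain g :: "complex \<Rightarrow> complex code" where g: "\<And>P. perfect_set P \<Longrightarrow> P \<noteq> {} \<Longrightarrow> g ` P = UNIV"
    using ex_bernstein_code[OF complex_lepoll_reals] by blast
  \<comment> \<open>The code \<open>([], \<lambda>_. 0)\<close> gives 0 at every set, so all
    generators vanish on the real axis, as does every polynomial in them without constant
    term.\<close>
  define h where "h x = (if x \<in> \<real> then ([], \<lambda>_. 0) else g x)" for x
  have h: "h x = g x" if "x \<notin> \<real>" for x using that by (simp add: h_def)
  have many: "{x \<in> U. h x = c} \<approx> (UNIV :: real set)" if U: "open U" "U \<noteq> {}" for U c
  proof (rule lepoll_antisym)
    show "{x \<in> U. h x = c} \<lesssim> (UNIV :: real set)"
      by (rule complex_lepoll_reals)
    \<comment> \<open>A vertical shift by \<open>e > 0\<close> leaves the real axis, so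
      \<open>z\<close> and its shift are not both real.\<close>
    have "U - \<real> \<noteq> {}"
    proof -
      obtain z e where ze: "e > 0" "cball z e \<subseteq> U" using U open_contains_cball by blast
      have "z \<in> U" "z + \<i> * of_real e \<in> U" using ze by (auto simp: subset_iff dist_norm norm_mult)
      moreover have "z \<notin> \<real> \<or> z + \<i> * of_real e \<notin> \<real>" using ze(1) by (auto simp: complex_is_Real_iff)
      ultimately show ?thesis by blast
    qed
    moreover have "open (U - \<real>)" using U(1) closed_complex_Reals by (rule open_Diff)
    moreover have "{x. g x = c} \<inter> Q \<noteq> {}" if "perfect_set Q" "Q \<noteq> {}" for Q
    proof -
      have "c \<in> g ` Q" using g[OF that] by simp
      then show ?thesis by blast
    qed
    ultimately have "{x. g x = c} \<inter> (U - \<real>) \<approx> (UNIV :: real set)"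
      by (intro eqpoll_reals_of_segments) auto
    moreover have "{x. g x = c} \<inter> (U - \<real>) \<lesssim> {x \<in> U. h x = c}"
      by (rule subset_imp_lepoll) (auto simp: h)
    ultimately show "(UNIV :: real set) \<lesssim> {x \<in> U. h x = c}"
      by (rule lepoll_trans1[OF eqpoll_sym])
  qed
  have "perfect_set (\<real> :: complex set)"
  proof (rule perfect_set_connected[of _ 0 1])
    show "connected (\<real> :: complex set)"
      unfolding Reals_def by (intro connected_continuous_image continuous_intros connected_UNIV)
  qed (auto simp: closed_complex_Reals)
  moreover have "(\<real> :: complex set) \<noteq> {}" by (metis Reals_0 empty_iff)
  ultimately have not_PES: "f \<notin> PES" if "f ` \<real> \<noteq> UNIV" for f
    using that unfolding PES_def by blast
  show ?thesis
  proof (rule strongly_algebrable_code)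
    have "c \<in> range h" for c
    proof -
      have "infinite {x \<in> UNIV. h x = c}"
        using many[of UNIV c] eqpoll_finite_iff infinite_UNIV_char_0 by blast
      then show ?thesis using not_finite_existsD by blast
    qed
    then show "surj h" by blast
  next
    fix n and P :: "complex mpoly" and A :: "nat \<Rightarrow> real set"
    assume P: "in_vars n P" "P \<noteq> 0" "Poly_Mapping.lookup P 0 = 0" and A: "inj_on A {..<n}"
    define F where "F x = mpoly_eval (*) P (\<lambda>i. code_eval (h x) (A i))" for x
    have "F x = 0" if "x \<in> \<real>" for x
      using mpoly_eval_zero[OF P(3)] that by (simp add: F_def h_def code_eval_def)
    then have "F ` \<real> \<subseteq> {0}" by auto
    then have "F ` \<real> \<noteq> UNIV" by (metis UNIV_I singletonD subsetD zero_neq_one)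
    then have "F \<notin> PES" by (rule not_PES)
    moreover have "{x \<in> U. F x = z} \<approx> (UNIV :: real set)" if U: "open U" "U \<noteq> {}" for U z
    proof (rule lepoll_antisym)
      show "{x \<in> U. F x = z} \<lesssim> (UNIV :: real set)"
        by (rule complex_lepoll_reals)
      obtain w where w: "mpoly_eval (*) P w = z" using surj_mpoly_eval_complex[OF P] by (metis surjD)
      obtain c where c: "\<forall>i\<in>{..<n}. code_eval c (A i) = w i"
        using ex_code_eval_eq[OF _ A] by blast
      have "F x = z" if "h x = c" for x
        unfolding F_def w[symmetric] using c that by (intro mpoly_eval_cong[OF P(1)]) auto
      \<comment> \<open>A fibre of \<open>F\<close> contains a whole fibre of \<open>h\<close>,
        which already has continuum many points in \<open>U\<close>.\<close>
      then have "{x \<in> U. h x = c} \<lesssim> {x \<in> U. F x = z}" by (intro subset_imp_lepoll) auto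
      then show "(UNIV :: real set) \<lesssim> {x \<in> U. F x = z}"
        by (rule lepoll_trans1[OF eqpoll_sym[OF many[OF U]]])
    qed
    ultimately show "(\<lambda>x. mpoly_eval (*) P (\<lambda>i. code_eval (h x) (A i))) \<in> SES - PES"
      unfolding SES_def F_def by blast
  qed
qed

text \<open>A connected set of reals with two points contains a nondegenerate segment, which is
  perfect. A polynomial in the generators therefore maps it onto the whole range of
  \<open>P\<close>, an interval containing 0 and some nonzero value.\<close>

lemma strongly_algebrable_EDD: "strongly_algebrable fun_scale EDD (UNIV :: real set set)"
proof -
  obtain h :: "real \<Rightarrow> real code" where h: "\<And>P. perfect_set P \<Longrightarrow> P \<noteq> {} \<Longrightarrow> h ` P = UNIV"
    using ex_bernstein_code[OF lepoll_refl] by blast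
  have hI: "h ` S = UNIV" if S: "connected S" "a \<in> S" "b \<in> S" "a \<noteq> b" for S a b
  proof -
    have "closed_segment a b \<subseteq> S"
      using S by (simp add: closed_segment_subset connected_convex_1 convex_contains_segment)
    moreover have "h ` closed_segment a b = UNIV" using S by (intro h perfect_set_closed_segment) auto
    ultimately show ?thesis by blast
  qed
  show ?thesis
  proof (rule strongly_algebrable_code)
    show "surj h" using hI[of UNIV 0 1] by simp
  next
    fix n and P :: "real mpoly" and A :: "nat \<Rightarrow> real set"
    assume P: "in_vars n P" "P \<noteq> 0" "Poly_Mapping.lookup P 0 = 0" and A: "inj_on A {..<n}"
    define F where "F x = mpoly_eval (*) P (\<lambda>i. code_eval (h x) (A i))" for x
    have F: "F ` S = range (mpoly_eval (*) P)" if "connected S" "a \<in> S" "b \<in> S" "a \<noteq> b" for S a b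
      unfolding F_def using image_mpoly_eval_code[OF P(1) A hI[OF that]] .
    have "connected (F ` S)" if S: "connected S" for S
    proof (cases "\<exists>a\<in>S. \<exists>b\<in>S. a \<noteq> b")
      case True
      then show ?thesis using F S connected_range_mpoly_eval_real by metis
    next
      case False
      then have "S = {} \<or> (\<exists>a. S = {a})" by blast
      then show ?thesis by auto
    qed
    moreover have "\<not> isCont F x" for x
    proof
      assume F': "isCont F x"
      obtain w where w: "mpoly_eval (*) P w \<noteq> 0" using ex_mpoly_eval_nonzero[OF P(1,2)] by blast
      \<comment> \<open>Every ball around \<open>x\<close> contains points with \<open>F\<close>
        values \<open>u\<close> and 0. Continuity at \<open>x\<close> would put both values within
        less than \<open>\<bar>u\<bar> / 2\<close> of \<open>F x\<close>, contradicting their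
        distance \<open>\<bar>u\<bar>\<close>.\<close>
      define u where "u = mpoly_eval (*) P w"
      have u: "u \<in> range (mpoly_eval (*) P)" "0 \<in> range (mpoly_eval (*) P)" "\<bar>u\<bar> / 2 > 0"
        using w mpoly_eval_zero[OF P(3)] by (auto simp: u_def image_iff intro: sym)
      obtain d where d: "d > 0" "\<And>y. dist y x < d \<Longrightarrow> dist (F y) (F x) < \<bar>u\<bar> / 2"
        using F' u(3) unfolding continuous_at_eps_delta by blast
      have "F ` ball x d = range (mpoly_eval (*) P)"
        using d(1) by (intro F[of _ x "x + d / 2"]) (auto simp: dist_real_def)
      then obtain y z where "y \<in> ball x d" "z \<in> ball x d" "F y = u" "F z = 0"
        using u by (metis imageE)
      then have "dist u (F x) < \<bar>u\<bar> / 2" "dist 0 (F x) < \<bar>u\<bar> / 2"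
        using d(2)[of y] d(2)[of z] by (auto simp: dist_commute)
      then show False unfolding dist_real_def by linarith
    qed
    ultimately show "(\<lambda>x. mpoly_eval (*) P (\<lambda>i. code_eval (h x) (A i))) \<in> EDD"
      unfolding EDD_def F_def by blast
  qed
qed

theorem theorem3p3:
  shows "strongly_algebrable fun_scale PES (UNIV :: real set set)
    \<and> strongly_algebrable fun_scale (SES - PES) (UNIV :: real set set)
    \<and> strongly_algebrable fun_scale EDD (UNIV :: real set set)"
  using strongly_algebrable_PES strongly_algebrable_SES_minus_PES strongly_algebrable_EDD by blast

end
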